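(* For $t\ge 1$ let $I_t:=\mathbf{1}\{x_t\in G_t\}\in\{0,1\}$ be the green-token indicators of a text generated under watermarking (the alternative hypothesis), and let $S_n:=\sum_{t=1}^n I_t$. Assume: (i) (information decay and stationarity) the process $\{I_t\}_{t\ge1}$ is strictly stationary, and there exist constants $C>0$ and $0<\rho<1$ such that for all $s<t$, $$\mathcal{I}(X_t^+;X_s^-)\le C\rho^{\,t-s},$$ where $X_t^+:=(I_i)_{i\ge t}$, $X_s^-:=(I_i)_{i<s}$ and $\mathcal{I}$ denotes mutual information; (ii) (non-degenerate long-run variance) $\sigma^2:=\lim_{n\to\infty}\frac1n\operatorname{Var}\left(\sum_{i=1}^n I_i\right)>0$. Suppose that $\mathbb{E} I_t=\gamma'$, where $0<\gamma'<1$. Then, for some constant $c>0$, $$\sqrt{n}\left(\frac{S_n}{n}-\gamma'\right)\xrightarrow{d}\mathcal{N}\left(0,\ c\,\gamma'(1-\gamma')\right)\qquad (n\to\infty).$$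
   Context: Here $x_t$ is the token generated at step $t$ and $G_t$ is the green list (a subset of the vocabulary) at step $t$; only the $\{0,1\}$-valued process $\{I_t\}$ and the listed assumptions on it matter for the statement. Mutual information is $\mathcal{I}(X;Y)=H(X)-H(X\mid Y)$, with $H$ the (Shannon) entropy; for infinite families of random variables it is understood in the usual sense as the supremum of the mutual informations between finite subfamilies (equivalently, the mutual information of the generated $\sigma$-fields). The existence of the limit defining $\sigma^2$ is part of assumption (ii). *)

theory Defs
  imports "HOL-Probability.Probability"
begin

definition green_indicator ::
  "(nat \<Rightarrow> 'a \<Rightarrow> 'v) \<Rightarrow> (nat \<Rightarrow> 'a \<Rightarrow> 'v set) \<Rightarrow> nat \<Rightarrow> 'a \<Rightarrow> real" where
  "green_indicator x G t \<omega> = (if x t \<omega> \<in> G t \<omega> then 1 else 0)"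

definition window :: "(nat \<Rightarrow> 'a \<Rightarrow> real) \<Rightarrow> nat set \<Rightarrow> 'a \<Rightarrow> nat \<Rightarrow> real" where
  "window X J \<omega> = (\<lambda>i\<in>J. X i \<omega>)"

text \<open>Processes are indexed by the times \<open>t \<ge> 1\<close>; the value at \<open>0\<close> is irrelevant throughout.\<close>

definition strictly_stationary :: "'a measure \<Rightarrow> (nat \<Rightarrow> 'a \<Rightarrow> real) \<Rightarrow> bool" where
  "strictly_stationary M X \<longleftrightarrow>
    (\<forall>J k. finite J \<and> J \<subseteq> {1..} \<longrightarrow>
      distr M (PiM J (\<lambda>_. borel)) (window (\<lambda>i. X (i + k)) J) =
      distr M (PiM J (\<lambda>_. borel)) (window X J))"

text \<open>
  Mutual information of two finite subfamilies of a process with finitely many values. The range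
  of each window is then finite, so the counting measures on the ranges are the right reference
  measures; this is \<open>\<I>(window X J ; window X K)\<close> in the locale \<^locale>\<open>information_space\<close>.
  Logarithms are to base 2; another base rescales all values by the same constant.
\<close>

definition window_mutual_information ::
  "'a measure \<Rightarrow> (nat \<Rightarrow> 'a \<Rightarrow> real) \<Rightarrow> nat set \<Rightarrow> nat set \<Rightarrow> real" where
  "window_mutual_information M X J K =
    prob_space.mutual_information M 2
      (count_space (window X J ` space M)) (count_space (window X K ` space M))
      (window X J) (window X K)"

lemma window_mutual_information_eq:
  assumes "prob_space M" "finite J" "finite K"
    and sf: "\<And>i. i \<in> J \<union> K \<Longrightarrow> simple_function M (X i)"
  shows "window_mutual_information M X J K =
    prob_space.entropy M 2 (count_space (window X J ` space M)) (window X J) -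
    prob_space.conditional_entropy M 2
      (count_space (window X J ` space M)) (count_space (window X K ` space M))
      (window X J) (window X K)"
proof -
  interpret prob_space M by fact
  interpret information_space M 2 by standard simp
  have "simple_function M (window X L)" if "finite L" "L \<subseteq> J \<union> K" for L
  proof -
    have fin: "finite (window X L ` space M)"
    proof (rule finite_subset)
      show "window X L ` space M \<subseteq> (\<Pi>\<^sub>E i\<in>L. X i ` space M)"
        by (auto simp: window_def)
      show "finite (\<Pi>\<^sub>E i\<in>L. X i ` space M)"
        using that sf by (intro finite_PiE) (auto dest: simple_functionD)
    qed
    have "window X L -` {y} \<inter> space M \<in> sets M" if y: "y \<in> window X L ` space M" for y
    proof -
      have eq: "window X L -` {y} \<inter> space M =
          {\<omega> \<in> space M. \<forall>i\<in>L. X i \<omega> \<in> {y i}}"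
        using y unfolding window_def by (auto simp: fun_eq_iff) meson+
      have "{\<omega> \<in> space M. X i \<omega> \<in> {y i}} \<in> sets M" if "i \<in> L" for i
        using simple_functionD(2)[OF sf[of i], of "{y i}"] that \<open>L \<subseteq> J \<union> K\<close>
        by (auto simp: vimage_def Int_def conj_commute)
      then show ?thesis
        unfolding eq using \<open>finite L\<close> by (intro sets.sets_Collect_finite_All) auto
    qed
    with fin show ?thesis by (auto simp: simple_function_def)
  qed
  then show ?thesis
    unfolding window_mutual_information_def using assms(2,3)
    by (intro mutual_information_eq_entropy_conditional_entropy) auto
qed

text \<open>
  The library's \<^const>\<open>prob_space.mutual_information\<close> is a real Bochner integral and hence
  \<open>0\<close> when the information is infinite, so for infinite families the supremum over finite
  subfamilies is taken in the extended reals.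
\<close>

definition process_mutual_information ::
  "'a measure \<Rightarrow> (nat \<Rightarrow> 'a \<Rightarrow> real) \<Rightarrow> nat set \<Rightarrow> nat set \<Rightarrow> ereal" where
  "process_mutual_information M X A B =
    (SUP (J, K) \<in> {J. finite J \<and> J \<subseteq> A} \<times> {K. finite K \<and> K \<subseteq> B}.
      ereal (window_mutual_information M X J K))"

end

theory Submission
  imports Defs
begin

text \<open>
  The mutual information of two windows is the divergence of their joint law from the product law
  and hence controls the total variation distance between the two. So functions of windows a
  distance \<open>d\<close> apart are decoupled up to an error of order \<open>\<rho> ^ (d / 2)\<close>. This makes covariances
  summable, so a sum over any finite set \<open>A\<close> of times has variance at most of order \<open>card A\<close>.
  Bernstein's method then gives the limit: cut \<open>{1..n}\<close> into blocks of length \<open>q\<^sup>2\<close> separated by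
  gaps of length \<open>q\<close>, where \<open>q\<close> is about \<open>n ^ (1 / 6)\<close>. The gaps are negligible in mean square, the
  characteristic function of the sum over the blocks nearly factorises, and a second-order
  expansion of each factor leaves \<open>exp (- \<sigma>2 * t\<^sup>2 / 2)\<close>, so \<open>c = \<sigma>2 / (\<gamma>' * (1 - \<gamma>'))\<close>.
\<close>

subsection \<open>Decoupling from mutual information\<close>

text \<open>The Kullback--Leibler divergence dominates the squared Hellinger distance because
  \<open>ln x \<le> x - 1\<close>, and Cauchy--Schwarz passes from Hellinger to total variation. The constant is
  worse than Pinsker's, but no calculus is needed.\<close>

lemma sum_abs_diff_le_sqrt_divergence:
  fixes p w :: "'i \<Rightarrow> real"
  assumes fin: "finite Z" and p: "\<And>z. z \<in> Z \<Longrightarrow> 0 \<le> p z" and w: "\<And>z. z \<in> Z \<Longrightarrow> 0 \<le> w z"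
    and ac: "\<And>z. z \<in> Z \<Longrightarrow> p z \<noteq> 0 \<Longrightarrow> w z \<noteq> 0"
    and p1: "sum p Z = 1" and w1: "sum w Z = 1"
  shows "(\<Sum>z\<in>Z. \<bar>p z - w z\<bar>) \<le> 2 * sqrt (\<Sum>z\<in>Z. p z * ln (p z / w z))"
proof -
  define h where "h z = sqrt (p z) - sqrt (w z)" for z
  define g where "g z = sqrt (p z) + sqrt (w z)" for z
  \<comment> \<open>The terms \<open>w z - p z\<close> sum to zero over \<open>Z\<close> but make
    the bound true pointwise. Applying the logarithm bound to the square root of the ratio, not to
    the ratio itself, is what produces the cross term \<open>sqrt (p z) * sqrt (w z)\<close> of the
    Hellinger square.\<close>
  have "(h z)\<^sup>2 \<le> p z * ln (p z / w z) + (w z - p z)" if "z \<in> Z" for z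
  proof (cases "p z = 0")
    case True
    then show ?thesis using w[OF that] by (simp add: h_def)
  next
    case False
    then have pos: "p z > 0" "w z > 0"
      using p w ac that by (force simp: less_le)+
    have "ln (sqrt (w z / p z)) \<le> sqrt (w z / p z) - 1"
      using pos by (intro ln_le_minus_one) auto
    then have "- ln (p z / w z) / 2 \<le> sqrt (w z / p z) - 1"
      using pos by (simp add: ln_sqrt ln_div)
    then have "p z * (- ln (p z / w z) / 2) \<le> p z * (sqrt (w z / p z) - 1)"
      using pos by (intro mult_left_mono) auto
    also have "p z * (sqrt (w z / p z) - 1) = sqrt (p z) * sqrt (w z) - p z"
    proof -
      have "p z * sqrt (w z / p z) = p z / sqrt (p z) * sqrt (w z)"
        by (simp add: real_sqrt_divide)
      then show ?thesis using pos by (simp add: real_div_sqrt right_diff_distrib)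
    qed
    finally show ?thesis
      using pos by (simp add: h_def power2_diff)
  qed
  then have "(\<Sum>z\<in>Z. (h z)\<^sup>2) \<le> (\<Sum>z\<in>Z. p z * ln (p z / w z) + (w z - p z))"
    by (rule sum_mono)
  also have "\<dots> = (\<Sum>z\<in>Z. p z * ln (p z / w z))"
    using p1 w1 by (simp add: sum.distrib sum_subtractf)
  finally have h: "(\<Sum>z\<in>Z. (h z)\<^sup>2) \<le> (\<Sum>z\<in>Z. p z * ln (p z / w z))" .
  have h0: "0 \<le> (\<Sum>z\<in>Z. p z * ln (p z / w z))"
    by (rule order.trans[OF sum_nonneg h]) simp
  have "(g z)\<^sup>2 \<le> 2 * (p z + w z)" if "z \<in> Z" for z
    using p[OF that] w[OF that] sum_squares_bound[of "sqrt (p z)" "sqrt (w z)"]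
    by (simp add: g_def power2_sum)
  then have "(\<Sum>z\<in>Z. (g z)\<^sup>2) \<le> (\<Sum>z\<in>Z. 2 * (p z + w z))"
    by (rule sum_mono)
  also have "\<dots> = 4"
    using p1 w1 by (simp add: sum.distrib flip: sum_distrib_left)
  finally have g: "(\<Sum>z\<in>Z. (g z)\<^sup>2) \<le> 4" .
  have "(\<Sum>z\<in>Z. \<bar>p z - w z\<bar>) = (\<Sum>z\<in>Z. \<bar>h z * g z\<bar>)"
    using p w by (intro sum.cong refl) (simp add: h_def g_def algebra_simps)
  also have "\<dots> \<le> L2_set h Z * L2_set g Z"
    using L2_set_mult_ineq[of h g Z] by (simp add: abs_mult)
  also have "\<dots> \<le> sqrt (\<Sum>z\<in>Z. p z * ln (p z / w z)) * sqrt 4"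
    unfolding L2_set_def using h g h0
    by (intro mult_mono real_sqrt_le_mono real_sqrt_ge_zero) (auto intro: sum_nonneg)
  finally show ?thesis by (simp add: mult.commute)
qed

text \<open>\<open>Z\<close> may exceed the range of \<open>X\<close>, so that an expectation under
  a joint law can be summed over the full product of two ranges, where the product law
  lives.\<close>

lemma (in prob_space) integral_simple_function_comp:
  fixes f :: "'b \<Rightarrow> complex"
  assumes X: "simple_function M X" and Z: "finite Z" "X ` space M \<subseteq> Z"
  shows "(LINT \<omega>|M. f (X \<omega>)) = (\<Sum>x\<in>Z. prob (X -` {x} \<inter> space M) *\<^sub>R f x)"
proof -
  have m: "X -` {x} \<inter> space M \<in> sets M" for x
    by (rule simple_functionD(2)[OF X])
  have "f (X \<omega>) = (\<Sum>x\<in>Z. indicator (X -` {x} \<inter> space M) \<omega> *\<^sub>R f x)" if "\<omega> \<in> space M" for \<omega>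
  proof -
    have "(\<Sum>x\<in>Z. indicator (X -` {x} \<inter> space M) \<omega> *\<^sub>R f x) = (\<Sum>x\<in>{X \<omega>}. f x)"
      using that Z by (intro sum.mono_neutral_cong_right) (auto simp: indicator_def)
    then show ?thesis by simp
  qed
  then have "(LINT \<omega>|M. f (X \<omega>)) =
      (LINT \<omega>|M. (\<Sum>x\<in>Z. indicator (X -` {x} \<inter> space M) \<omega> *\<^sub>R f x))"
    by (intro Bochner_Integration.integral_cong) auto
  also have "\<dots> = (\<Sum>x\<in>Z. prob (X -` {x} \<inter> space M) *\<^sub>R f x)"
    using m by (subst Bochner_Integration.integral_sum) (auto simp: integrable_scaleR_left emeasure_eq_measure)
  finally show ?thesis .
qed

text \<open>\<open>ln b * \<I>(X ; Y)\<close> is the divergence, in natural logarithms, of the joint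
  law \<open>P\<close> from the product law \<open>W\<close>. The difference of expectations is the
  sum of \<open>f * g\<close> against \<open>P - W\<close>, hence at most the L1 distance of the two
  laws.\<close>

lemma (in information_space) decoupling_le_sqrt_mutual_information:
  fixes f :: "'b \<Rightarrow> complex" and g :: "'c \<Rightarrow> complex"
  assumes X: "simple_function M X" and Y: "simple_function M Y"
    and f: "\<And>x. norm (f x) \<le> 1" and g: "\<And>y. norm (g y) \<le> 1"
  shows "norm ((LINT \<omega>|M. f (X \<omega>) * g (Y \<omega>)) - (LINT \<omega>|M. f (X \<omega>)) * (LINT \<omega>|M. g (Y \<omega>)))
    \<le> 2 * sqrt (ln b * \<I>(X ; Y))"
proof -
  let ?XY = "\<lambda>\<omega>. (X \<omega>, Y \<omega>)"
  define Px where "Px x = prob (X -` {x} \<inter> space M)" for x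
  define Py where "Py y = prob (Y -` {y} \<inter> space M)" for y
  define P where "P z = prob (?XY -` {z} \<inter> space M)" for z
  define W where "W z = Px (fst z) * Py (snd z)" for z
  define Z where "Z = X ` space M \<times> Y ` space M"
  have XY: "simple_function M ?XY"
    using X Y by (rule simple_function_Pair)
  have fin: "finite (X ` space M)" "finite (Y ` space M)" "finite Z"
    using X Y by (auto simp: Z_def simple_functionD)
  have sdX: "simple_distributed M X Px" and sdY: "simple_distributed M Y Py"
    and sdXY: "simple_distributed M ?XY P"
    using X Y XY by (auto intro!: simple_distributedI simp: Px_def Py_def P_def)
  have sub: "?XY ` space M \<subseteq> Z"
    by (auto simp: Z_def)
  \<comment> \<open>Pairs that never occur together have mass zero, so enlarging the joint range to
    the product \<open>Z\<close> changes neither the total mass nor the divergence.\<close>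
  have P0: "P z = 0" if "z \<notin> ?XY ` space M" for z
  proof -
    have "?XY -` {z} \<inter> space M = {}" using that by auto
    then show ?thesis by (simp add: P_def)
  qed
  have sumX: "sum Px (X ` space M) = 1" and sumY: "sum Py (Y ` space M) = 1"
    using simple_distributed_sum_space sdX sdY by auto
  have "sum P Z = sum P (?XY ` space M)"
    using sub fin P0 by (intro sum.mono_neutral_right) auto
  then have sumP: "sum P Z = 1"
    using simple_distributed_sum_space[OF sdXY] by simp
  have sumW: "sum W Z = 1"
    using sum_product[of Px "X ` space M" Py "Y ` space M"] sumX sumY
    by (simp add: Z_def W_def sum.cartesian_product split_beta)
  have ac: "W z \<noteq> 0" if "P z \<noteq> 0" for z
  proof -
    have "P z \<le> Px (fst z)" "P z \<le> Py (snd z)"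
      unfolding P_def Px_def Py_def using simple_functionD(2)[OF X] simple_functionD(2)[OF Y]
      by (auto intro!: finite_measure_mono)
    moreover have "P z > 0" using that by (simp add: P_def zero_less_measure_iff)
    ultimately show ?thesis by (auto simp: W_def)
  qed
  have lnb: "ln b > 0" using b_gt_1 by simp
  have "ln b * \<I>(X ; Y) = (\<Sum>z\<in>?XY ` space M. P z * ln (P z / W z))"
    unfolding mutual_information_simple_distributed[OF sdX sdY sdXY] sum_distrib_left
    using lnb by (intro sum.cong refl) (auto simp: log_def W_def)
  also have "\<dots> = (\<Sum>z\<in>Z. P z * ln (P z / W z))"
    using sub fin P0 by (intro sum.mono_neutral_left) auto
  finally have MI: "ln b * \<I>(X ; Y) = (\<Sum>z\<in>Z. P z * ln (P z / W z))" .
  have "(LINT \<omega>|M. f (X \<omega>) * g (Y \<omega>)) = (\<Sum>z\<in>Z. P z *\<^sub>R (f (fst z) * g (snd z)))"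
    using integral_simple_function_comp[OF XY \<open>finite Z\<close> sub, of "\<lambda>z. f (fst z) * g (snd z)"]
    by (simp add: P_def)
  moreover have "(LINT \<omega>|M. f (X \<omega>)) * (LINT \<omega>|M. g (Y \<omega>)) =
      (\<Sum>z\<in>Z. W z *\<^sub>R (f (fst z) * g (snd z)))"
    using integral_simple_function_comp[OF X fin(1), of f] integral_simple_function_comp[OF Y fin(2), of g]
    by (simp add: Z_def W_def Px_def Py_def sum_product sum.cartesian_product mult_ac split_beta)
  ultimately have "norm ((LINT \<omega>|M. f (X \<omega>) * g (Y \<omega>)) - (LINT \<omega>|M. f (X \<omega>)) * (LINT \<omega>|M. g (Y \<omega>)))
      = norm (\<Sum>z\<in>Z. (P z - W z) *\<^sub>R (f (fst z) * g (snd z)))"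
    by (simp add: sum_subtractf scaleR_left_diff_distrib)
  also have "\<dots> \<le> (\<Sum>z\<in>Z. \<bar>P z - W z\<bar>)"
  proof (rule sum_norm_le)
    fix z
    have "norm (f (fst z)) * norm (g (snd z)) \<le> 1"
      using f g by (intro mult_le_one) auto
    then show "norm ((P z - W z) *\<^sub>R (f (fst z) * g (snd z))) \<le> \<bar>P z - W z\<bar>"
      using mult_left_mono[of _ 1 "\<bar>P z - W z\<bar>"] by (simp add: norm_mult)
  qed
  also have "\<dots> \<le> 2 * sqrt (\<Sum>z\<in>Z. P z * ln (P z / W z))"
    using fin ac sumP sumW
    by (intro sum_abs_diff_le_sqrt_divergence) (auto simp: P_def W_def Px_def Py_def)
  finally show ?thesis by (simp add: MI)
qed

subsection \<open>Second moments under geometric mixing\<close>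

text \<open>On either side of \<open>i\<close> the distance to \<open>i\<close> is injective, so
  each half is part of one geometric series.\<close>

lemma sum_power_abs_diff_le:
  fixes r :: real and A :: "nat set"
  assumes r: "0 < r" "r < 1" and A: "finite A"
  shows "(\<Sum>j\<in>A. r ^ nat \<bar>int i - int j\<bar>) \<le> 2 / (1 - r)"
proof -
  have inj: "(\<Sum>j\<in>B. r ^ h j) \<le> 1 / (1 - r)" if "B \<subseteq> A" "inj_on h B" for B and h :: "nat \<Rightarrow> nat"
  proof -
    have "(\<Sum>j\<in>B. r ^ h j) = (\<Sum>d\<in>h ` B. r ^ d)"
      using that(2) by (simp add: sum.reindex)
    also have "\<dots> \<le> (\<Sum>d. r ^ d)"
      using r that(1) A by (intro sum_le_suminf summable_geometric) (auto intro: finite_subset)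
    finally show ?thesis using r by (simp add: suminf_geometric)
  qed
  have "(\<Sum>j\<in>A. r ^ nat \<bar>int i - int j\<bar>) =
      (\<Sum>j\<in>A \<inter> {..i}. r ^ nat \<bar>int i - int j\<bar>) + (\<Sum>j\<in>A - {..i}. r ^ nat \<bar>int i - int j\<bar>)"
    using A by (rule sum.Int_Diff)
  also have "\<dots> \<le> 1 / (1 - r) + 1 / (1 - r)"
    by (intro add_mono inj) (auto simp: inj_on_def)
  finally show ?thesis by simp
qed

text \<open>Here the information hypothesis survives only as \<open>decoupling\<close>. Complex
  functions let it serve covariances and characteristic functions alike. Since \<open>K\<close> ends
  before \<open>s\<close>, the exponent \<open>t - s\<close> is one less than the smallest distance
  these constraints allow between a time in \<open>J\<close> and one in \<open>K\<close>.\<close>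

locale bounded_mixing = prob_space M for M :: "'a measure" +
  fixes X :: "nat \<Rightarrow> 'a \<Rightarrow> real" and \<mu> B r :: real
  assumes random_variable_X: "1 \<le> i \<Longrightarrow> random_variable borel (X i)"
    and bounded_X: "1 \<le> i \<Longrightarrow> \<omega> \<in> space M \<Longrightarrow> \<bar>X i \<omega> - \<mu>\<bar> \<le> 1"
    and mean_X: "1 \<le> i \<Longrightarrow> expectation (X i) = \<mu>"
    and stationary_X: "strictly_stationary M X"
    and B_nonneg: "0 \<le> B" and r_pos: "0 < r" and r_less_1: "r < 1"
    and decoupling: "\<lbrakk>1 \<le> s; s < t; finite J; finite K; J \<subseteq> {t..}; K \<subseteq> {1..<s};
      f \<in> borel_measurable (PiM J (\<lambda>_. borel)); g \<in> borel_measurable (PiM K (\<lambda>_. borel));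
      \<And>w. norm (f w :: complex) \<le> 1; \<And>w. norm (g w :: complex) \<le> 1\<rbrakk> \<Longrightarrow>
      norm ((LINT \<omega>|M. f (window X J \<omega>) * g (window X K \<omega>)) -
        (LINT \<omega>|M. f (window X J \<omega>)) * (LINT \<omega>|M. g (window X K \<omega>))) \<le> B * r ^ (t - s)"
begin

text \<open>The index is a set of times because blocks, unions of blocks and left-over times are all
  summed in the same way.\<close>

definition csum :: "nat set \<Rightarrow> 'a \<Rightarrow> real" where
  "csum A \<omega> = (\<Sum>i\<in>A. X i \<omega> - \<mu>)"

lemma csum_measurable [measurable]: "A \<subseteq> {1..} \<Longrightarrow> csum A \<in> borel_measurable M"
  unfolding csum_def[abs_def] using random_variable_X
  by (intro borel_measurable_sum borel_measurable_diff) auto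

lemma csum_bound:
  assumes "A \<subseteq> {1..}" "\<omega> \<in> space M"
  shows "\<bar>csum A \<omega>\<bar> \<le> card A"
proof -
  have "\<bar>csum A \<omega>\<bar> \<le> (\<Sum>i\<in>A. \<bar>X i \<omega> - \<mu>\<bar>)"
    unfolding csum_def by (rule sum_abs)
  also have "\<dots> \<le> (\<Sum>i\<in>A. 1)"
    using assms bounded_X by (intro sum_mono) auto
  finally show ?thesis by simp
qed

lemma integrable_bounded:
  fixes h :: "'a \<Rightarrow> real"
  assumes "h \<in> borel_measurable M" "\<And>\<omega>. \<omega> \<in> space M \<Longrightarrow> \<bar>h \<omega>\<bar> \<le> c"
  shows "integrable M h"
  using assms by (intro integrable_const_bound[where B = c]) auto

lemma integrable_deviation: "1 \<le> i \<Longrightarrow> integrable M (\<lambda>\<omega>. X i \<omega> - \<mu>)"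
  using random_variable_X bounded_X by (intro integrable_bounded[where c = 1]) auto

lemma integrable_deviation_mult:
  assumes "1 \<le> i" "1 \<le> j"
  shows "integrable M (\<lambda>\<omega>. (X i \<omega> - \<mu>) * (X j \<omega> - \<mu>))"
  using assms random_variable_X bounded_X
  by (intro integrable_bounded[where c = 1]) (auto simp: abs_mult intro!: mult_le_one)

lemma integrable_csum: "A \<subseteq> {1..} \<Longrightarrow> integrable M (csum A)"
  using csum_bound by (intro integrable_bounded[where c = "card A"]) auto

lemma integrable_csum_sq: "A \<subseteq> {1..} \<Longrightarrow> integrable M (\<lambda>\<omega>. (csum A \<omega>)\<^sup>2)"
  using csum_bound power_mono[of "\<bar>csum A _\<bar>" "card A" 2]
  by (intro integrable_bounded[where c = "(card A)\<^sup>2"]) auto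

lemma expectation_deviation: "1 \<le> i \<Longrightarrow> expectation (\<lambda>\<omega>. X i \<omega> - \<mu>) = 0"
proof -
  assume i: "1 \<le> i"
  have "integrable M (\<lambda>\<omega>. (X i \<omega> - \<mu>) + \<mu>)"
    using integrable_deviation[OF i] by (intro Bochner_Integration.integrable_add) auto
  then have "integrable M (X i)" by simp
  then show ?thesis using mean_X[OF i] by (simp add: prob_space)
qed

lemma expectation_csum:
  assumes "A \<subseteq> {1..}"
  shows "expectation (csum A) = 0"
proof -
  have "expectation (csum A) = (\<Sum>i\<in>A. expectation (\<lambda>\<omega>. X i \<omega> - \<mu>))"
    unfolding csum_def[abs_def] using assms integrable_deviation
    by (intro Bochner_Integration.integral_sum) auto
  also have "\<dots> = 0"
    using assms expectation_deviation by (intro sum.neutral) auto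
  finally show ?thesis .
qed

text \<open>Decoupling applies to the single times \<open>j\<close> and \<open>i\<close> with
  \<open>t = j\<close> and \<open>s = i + 1\<close>; this excludes neighbours and costs one in the
  exponent. The product of the means vanishes by centring.\<close>

lemma covariance_far:
  assumes "1 \<le> i" "i + 1 < j"
  shows "\<bar>expectation (\<lambda>\<omega>. (X j \<omega> - \<mu>) * (X i \<omega> - \<mu>))\<bar> \<le> B * r ^ (j - i - 1)"
proof -
  \<comment> \<open>Decoupling asks for functions bounded on all of \<open>PiM\<close>, not just on the range of the process.\<close>
  define clip where "clip k w = complex_of_real (max (- 1) (min 1 (w k - \<mu>)))"
    for k :: nat and w :: "nat \<Rightarrow> real"
  have clip: "clip k (window X {k} \<omega>) = X k \<omega> - \<mu>" if "1 \<le> k" "\<omega> \<in> space M" for k \<omega>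
    using bounded_X[OF that] by (auto simp: clip_def window_def)
  have meas: "clip k \<in> borel_measurable (PiM {k} (\<lambda>_. borel))" for k
    unfolding clip_def by measurable
  have "norm (clip k w) \<le> 1" for k w
    unfolding clip_def norm_of_real by auto
  then have "norm ((LINT \<omega>|M. clip j (window X {j} \<omega>) * clip i (window X {i} \<omega>)) -
      (LINT \<omega>|M. clip j (window X {j} \<omega>)) * (LINT \<omega>|M. clip i (window X {i} \<omega>)))
      \<le> B * r ^ (j - (i + 1))"
    using assms by (intro decoupling meas) auto
  moreover have "(LINT \<omega>|M. clip j (window X {j} \<omega>) * clip i (window X {i} \<omega>)) =
      (LINT \<omega>|M. complex_of_real ((X j \<omega> - \<mu>) * (X i \<omega> - \<mu>)))"
    using assms by (intro Bochner_Integration.integral_cong) (auto simp: clip)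
  moreover have "(LINT \<omega>|M. clip i (window X {i} \<omega>)) = (LINT \<omega>|M. complex_of_real (X i \<omega> - \<mu>))"
    using assms by (intro Bochner_Integration.integral_cong) (auto simp: clip)
  moreover have "(LINT \<omega>|M. complex_of_real (X i \<omega> - \<mu>)) = 0"
    using expectation_deviation[OF assms(1)] unfolding integral_complex_of_real by simp
  ultimately show ?thesis
    unfolding integral_complex_of_real by (simp del: of_real_diff of_real_mult)
qed

text \<open>The factor \<open>1 / r\<close> repays the exponent lost in
  \<open>covariance_far\<close>. Replacing \<open>B\<close> by \<open>B + 1\<close> makes the bound
  at least 1 at distance 0 or 1, where only the trivial estimate is available.\<close>

lemma covariance_bound:
  assumes "1 \<le> i" "1 \<le> j"
  shows "\<bar>expectation (\<lambda>\<omega>. (X i \<omega> - \<mu>) * (X j \<omega> - \<mu>))\<bar> \<le> (B + 1) / r * r ^ nat \<bar>int i - int j\<bar>"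
proof -
  have far: "B * r ^ (b - a - 1) \<le> (B + 1) / r * r ^ (b - a)" if "a + 1 < b" for a b :: nat
  proof -
    have "(B + 1) / r * r ^ (b - a) = (B + 1) * r ^ (b - a - 1)"
      using that r_pos by (cases "b - a") auto
    then show ?thesis using r_pos by (simp add: mult_right_mono)
  qed
  consider "i + 1 < j" | "j + 1 < i" | "nat \<bar>int i - int j\<bar> \<le> 1" by linarith
  then show ?thesis
  proof cases
    case 1
    then have "nat \<bar>int i - int j\<bar> = j - i" by auto
    then show ?thesis
      using order.trans[OF covariance_far[OF assms(1) 1] far[OF 1]]
      by (simp only: mult.commute[of "X i _ - \<mu>"])
  next
    case 2
    then have "nat \<bar>int i - int j\<bar> = i - j" by auto
    then show ?thesis
      using order.trans[OF covariance_far[OF assms(2) 2] far[OF 2]] by metis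
  next
    case 3
    have "\<bar>expectation (\<lambda>\<omega>. (X i \<omega> - \<mu>) * (X j \<omega> - \<mu>))\<bar> \<le>
        expectation (\<lambda>\<omega>. \<bar>(X i \<omega> - \<mu>) * (X j \<omega> - \<mu>)\<bar>)"
      by (rule integral_abs_bound)
    also have "\<dots> \<le> expectation (\<lambda>\<omega>. 1)"
      using assms integrable_deviation_mult bounded_X
      by (intro integral_mono integrable_abs) (auto simp: abs_mult intro!: mult_le_one)
    also have "\<dots> \<le> (B + 1) / r * r"
      using B_nonneg r_pos by (simp add: prob_space)
    also have "\<dots> \<le> (B + 1) / r * r ^ nat \<bar>int i - int j\<bar>"
      using B_nonneg r_pos r_less_1 power_decreasing[OF 3, of r]
      by (intro mult_left_mono) auto
    finally show ?thesis .
  qed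
qed

text \<open>Bounds every row sum of the covariance matrix, for any finite set of times.\<close>

definition var_const :: real where "var_const = (B + 1) / r * (2 / (1 - r))"

lemma var_const_pos: "0 < var_const"
  using B_nonneg r_pos r_less_1 by (simp add: var_const_def)

text \<open>Expanding the square gives one row of covariances for each element of \<open>A\<close>,
  and the row bound does not depend on where the times lie. Scattered sets matter because the
  left-over gaps form one.\<close>

lemma csum_second_moment:
  assumes A: "finite A" "A \<subseteq> {1..}"
  shows "expectation (\<lambda>\<omega>. (csum A \<omega>)\<^sup>2) \<le> var_const * card A"
proof -
  have "expectation (\<lambda>\<omega>. (csum A \<omega>)\<^sup>2) =
      (\<Sum>i\<in>A. \<Sum>j\<in>A. expectation (\<lambda>\<omega>. (X i \<omega> - \<mu>) * (X j \<omega> - \<mu>)))"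
  proof -
    have int: "integrable M (\<lambda>\<omega>. (X i \<omega> - \<mu>) * (X j \<omega> - \<mu>))" if "i \<in> A" "j \<in> A" for i j
      using A that by (intro integrable_deviation_mult) auto
    have "expectation (\<lambda>\<omega>. (csum A \<omega>)\<^sup>2) =
        (\<Sum>i\<in>A. expectation (\<lambda>\<omega>. \<Sum>j\<in>A. (X i \<omega> - \<mu>) * (X j \<omega> - \<mu>)))"
      unfolding csum_def power2_eq_square sum_product
      by (intro Bochner_Integration.integral_sum Bochner_Integration.integrable_sum int)
    also have "\<dots> = (\<Sum>i\<in>A. \<Sum>j\<in>A. expectation (\<lambda>\<omega>. (X i \<omega> - \<mu>) * (X j \<omega> - \<mu>)))"
      by (intro sum.cong refl Bochner_Integration.integral_sum int)
    finally show ?thesis .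
  qed
  also have "\<dots> \<le> (\<Sum>i\<in>A. \<Sum>j\<in>A. (B + 1) / r * r ^ nat \<bar>int i - int j\<bar>)"
    using A by (intro sum_mono order.trans[OF abs_ge_self covariance_bound]) auto
  also have "\<dots> \<le> (\<Sum>i\<in>A. var_const)"
    unfolding var_const_def sum_distrib_left[symmetric]
    using B_nonneg r_pos r_less_1 A by (intro sum_mono mult_left_mono sum_power_abs_diff_le) auto
  finally show ?thesis by (simp add: mult.commute)
qed

text \<open>The sum is a measurable function of the window, so it inherits stationarity. This gives
  all blocks the same characteristic function.\<close>

lemma csum_shift_distr:
  "distr M borel (csum {k + 1..k + p}) = distr M borel (csum {1..p})"
proof -
  let ?N = "PiM {1..p} (\<lambda>_. borel) :: (nat \<Rightarrow> real) measure"
  let ?s = "\<lambda>w. \<Sum>i\<in>{1..p}. w i - \<mu>"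
  have meas: "window (\<lambda>i. X (i + l)) {1..p} \<in> measurable M ?N" for l
    unfolding window_def[abs_def] using random_variable_X
    by (intro measurable_restrict) auto
  have s: "?s \<in> borel_measurable ?N" by measurable
  have "distr M borel (\<lambda>\<omega>. ?s (window (\<lambda>i. X (i + k)) {1..p} \<omega>)) =
      distr (distr M ?N (window (\<lambda>i. X (i + k)) {1..p})) borel ?s"
    using distr_distr[OF s meas[of k]] by (simp add: comp_def)
  also have "distr M ?N (window (\<lambda>i. X (i + k)) {1..p}) = distr M ?N (window X {1..p})"
    using stationary_X by (auto simp: strictly_stationary_def)
  also have "distr \<dots> borel ?s = distr M borel (\<lambda>\<omega>. ?s (window X {1..p} \<omega>))"
    using distr_distr[OF s meas[of 0]] by (simp add: comp_def)
  also have "(\<lambda>\<omega>. ?s (window X {1..p} \<omega>)) = csum {1..p}"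
    by (auto simp: csum_def window_def)
  also have "(\<lambda>\<omega>. ?s (window (\<lambda>i. X (i + k)) {1..p} \<omega>)) = csum {k + 1..k + p}"
    using sum.shift_bounds_cl_nat_ivl[of "\<lambda>i. X i _ - \<mu>" 1 k p]
    by (auto simp: csum_def window_def add.commute)
  finally show ?thesis .
qed

section \<open>Bernstein blocks and their characteristic functions\<close>

lemma char_csum:
  assumes "A \<subseteq> {1..}"
  shows "char (distr M borel (csum A)) \<theta> = (LINT \<omega>|M. iexp (\<theta> * csum A \<omega>))"
  unfolding char_def using assms by (subst integral_distr) auto

text \<open>Periods of length \<open>p + q\<close> are numbered from 0, and the gap closes its
  period, so each new block is already separated from all earlier ones.\<close>

definition block :: "nat \<Rightarrow> nat \<Rightarrow> nat \<Rightarrow> nat set" where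
  "block p q j = {j * (p + q) + 1..j * (p + q) + p}"

definition blocks :: "nat \<Rightarrow> nat \<Rightarrow> nat \<Rightarrow> nat set" where
  "blocks p q m = (\<Union>j<m. block p q j)"

lemma blocks_subset: "blocks p q m \<subseteq> {1..<m * (p + q) + 1}"
proof
  fix i assume "i \<in> blocks p q m"
  then obtain j where j: "j < m" "i \<in> block p q j" by (auto simp: blocks_def)
  then have "Suc j * (p + q) \<le> m * (p + q)" by (intro mult_le_mono1) auto
  then show "i \<in> {1..<m * (p + q) + 1}" using j(2) by (auto simp: block_def)
qed

lemma finite_blocks [simp]: "finite (blocks p q m)"
  by (simp add: blocks_def block_def)

lemma blocks_Suc: "blocks p q (Suc m) = blocks p q m \<union> block p q m"
  by (auto simp: blocks_def less_Suc_eq)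

text \<open>The summand \<open>q\<close> is the gap after the last block. It is the separation that
  decoupling needs from the block starting at \<open>m * (p + q) + 1\<close>.\<close>

lemma blocks_below:
  assumes "i \<in> blocks p q m"
  shows "i + q \<le> m * (p + q)"
proof -
  obtain j where j: "j < m" "i \<in> block p q j" using assms by (auto simp: blocks_def)
  then have "Suc j * (p + q) \<le> m * (p + q)" by (intro mult_le_mono1) auto
  then show ?thesis using j(2) by (auto simp: block_def)
qed

lemma blocks_disjoint: "blocks p q m \<inter> block p q m = {}"
  by (auto dest!: blocks_below simp: block_def)

lemma card_blocks: "card (blocks p q m) = m * p"
proof (induction m)
  case (Suc m)
  then show ?case
    using blocks_disjoint[of p q m] by (simp add: blocks_Suc card_Un_disjoint block_def)
qed (simp add: blocks_def)

text \<open>Splitting off the newest block costs one decoupling error \<open>B * r ^ q\<close>. Its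
  characteristic function has modulus at most 1, so the errors made earlier are not amplified and
  simply add up.\<close>

lemma char_blocks:
  fixes \<theta> :: real
  assumes q: "1 \<le> q"
  shows "norm ((LINT \<omega>|M. iexp (\<theta> * csum (blocks p q m) \<omega>)) -
    (LINT \<omega>|M. iexp (\<theta> * csum {1..p} \<omega>)) ^ m) \<le> m * (B * r ^ q)"
proof (induction m)
  case 0
  show ?case by (simp add: blocks_def csum_def prob_space)
next
  case (Suc m)
  let ?E = "\<lambda>A. LINT \<omega>|M. iexp (\<theta> * csum A \<omega>)"
  let ?e = "\<lambda>A w. iexp (\<theta> * (\<Sum>i\<in>A. w i - \<mu>))"
  let ?\<psi> = "?E {1..p}"
  have win: "?e A (window X A \<omega>) = iexp (\<theta> * csum A \<omega>)" for A \<omega>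
    by (simp add: csum_def window_def)
  have meas: "?e A \<in> borel_measurable (PiM A (\<lambda>_. borel))" for A
    by measurable
  have psi: "?E (block p q m) = ?\<psi>"
    using csum_shift_distr[of "m * (p + q)" p] char_csum[of "block p q m" \<theta>] char_csum[of "{1..p}" \<theta>]
    by (simp add: block_def subset_eq)
  have "norm ?\<psi> \<le> 1"
    using real_distribution.cmod_char_le_1[OF real_distribution_distr, of "csum {1..p}" \<theta>]
      char_csum[of "{1..p}" \<theta>] by auto
  have split: "?E (blocks p q (Suc m)) =
      (LINT \<omega>|M. iexp (\<theta> * csum (block p q m) \<omega>) * iexp (\<theta> * csum (blocks p q m) \<omega>))"
  proof (intro Bochner_Integration.integral_cong refl)
    fix \<omega>
    have "csum (blocks p q (Suc m)) \<omega> = csum (blocks p q m) \<omega> + csum (block p q m) \<omega>"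
      unfolding csum_def blocks_Suc using blocks_disjoint[of p q m]
      by (intro sum.union_disjoint) (auto simp: block_def)
    then show "iexp (\<theta> * csum (blocks p q (Suc m)) \<omega>) =
        iexp (\<theta> * csum (block p q m) \<omega>) * iexp (\<theta> * csum (blocks p q m) \<omega>)"
      by (simp add: exp_add[symmetric] algebra_simps)
  qed
  \<comment> \<open>For \<open>m = 0\<close> no block precedes, and \<open>?t - q\<close> would be
    0, which is not an admissible \<open>s\<close>. Otherwise \<open>s = ?t - q\<close> is
    admissible by \<open>blocks_below\<close>.\<close>
  have step: "norm (?E (blocks p q (Suc m)) - ?\<psi> * ?E (blocks p q m)) \<le> B * r ^ q"
  proof (cases "m = 0")
    case True
    then show ?thesis
      using split psi B_nonneg r_pos by (simp add: blocks_def csum_def prob_space)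
  next
    case False
    let ?t = "m * (p + q) + 1"
    from False have "q \<le> m * (p + q)" by (cases m) auto
    then have "norm ((LINT \<omega>|M. ?e (block p q m) (window X (block p q m) \<omega>) *
          ?e (blocks p q m) (window X (blocks p q m) \<omega>)) -
        (LINT \<omega>|M. ?e (block p q m) (window X (block p q m) \<omega>)) *
        (LINT \<omega>|M. ?e (blocks p q m) (window X (blocks p q m) \<omega>))) \<le> B * r ^ (?t - (?t - q))"
      using q blocks_subset[of p q m] blocks_below[of _ p q m]
      by (intro decoupling meas) (fastforce simp: block_def)+
    moreover have "?t - (?t - q) = q" using \<open>q \<le> m * (p + q)\<close> by auto
    ultimately show ?thesis unfolding win split psi by simp
  qed
  have "norm (?E (blocks p q (Suc m)) - ?\<psi> ^ Suc m) \<le>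
      norm (?E (blocks p q (Suc m)) - ?\<psi> * ?E (blocks p q m)) + norm (?\<psi> * (?E (blocks p q m) - ?\<psi> ^ m))"
    by (rule order.trans[OF _ norm_triangle_ineq]) (simp add: algebra_simps)
  also have "\<dots> \<le> B * r ^ q + 1 * (m * (B * r ^ q))"
    unfolding norm_mult using step Suc.IH \<open>norm ?\<psi> \<le> 1\<close> by (intro add_mono mult_mono) auto
  finally show ?case by (simp add: algebra_simps)
qed

text \<open>The mean is zero, so the second-order expansion is \<open>1 - x\<close> with
  \<open>x = \<theta>\<^sup>2 * v p / 2\<close>. The first error term is the Taylor remainder, the
  second the price of replacing \<open>1 - x\<close> by \<open>exp (- x)\<close>.\<close>

lemma char_block_taylor:
  fixes \<theta> :: real and p :: nat and v :: "nat \<Rightarrow> real"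
  defines "v \<equiv> \<lambda>p. expectation (\<lambda>\<omega>. (csum {1..p} \<omega>)\<^sup>2)"
  shows "norm ((LINT \<omega>|M. iexp (\<theta> * csum {1..p} \<omega>)) - complex_of_real (exp (- (\<theta>\<^sup>2 * v p / 2)))) \<le>
    \<bar>\<theta>\<bar> ^ 3 * p * v p / 6 + (\<theta>\<^sup>2 * v p / 2)\<^sup>2"
proof -
  let ?U = "csum {1..p}"
  let ?x = "\<theta>\<^sup>2 * v p / 2"
  have sub: "{1..p} \<subseteq> {1..}" by auto
  have v0: "0 \<le> v p" unfolding v_def by (rule integral_nonneg_AE) auto
  have "cmod (char (distr M borel ?U) \<theta> - (1 - \<theta>\<^sup>2 * v p / 2)) \<le>
      (\<theta>\<^sup>2 / 6) * expectation (\<lambda>\<omega>. min (6 * (?U \<omega>)\<^sup>2) (\<bar>\<theta>\<bar> * \<bar>?U \<omega>\<bar> ^ 3))"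
    using expectation_csum[OF sub] integrable_csum[OF sub] integrable_csum_sq[OF sub]
    by (intro char_approx3') (auto simp: v_def)
  \<comment> \<open>A sum of \<open>p\<close> terms bounded by 1 is at most \<open>p\<close> in
    absolute value, so its third absolute moment is at most \<open>p\<close> times the second
    moment.\<close>
  also have "expectation (\<lambda>\<omega>. min (6 * (?U \<omega>)\<^sup>2) (\<bar>\<theta>\<bar> * \<bar>?U \<omega>\<bar> ^ 3)) \<le>
      expectation (\<lambda>\<omega>. \<bar>\<theta>\<bar> * p * (?U \<omega>)\<^sup>2)"
  proof (rule integral_mono_AE')
    show "integrable M (\<lambda>\<omega>. \<bar>\<theta>\<bar> * p * (?U \<omega>)\<^sup>2)"
      using integrable_csum_sq[OF sub] by simp
    show "AE \<omega> in M. min (6 * (?U \<omega>)\<^sup>2) (\<bar>\<theta>\<bar> * \<bar>?U \<omega>\<bar> ^ 3) \<le> \<bar>\<theta>\<bar> * p * (?U \<omega>)\<^sup>2"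
    proof (rule AE_I2)
      fix \<omega> assume "\<omega> \<in> space M"
      then have "\<bar>?U \<omega>\<bar> * (?U \<omega>)\<^sup>2 \<le> p * (?U \<omega>)\<^sup>2"
        using csum_bound[OF sub] by (intro mult_right_mono) auto
      then have "\<bar>\<theta>\<bar> * (\<bar>?U \<omega>\<bar> * (?U \<omega>)\<^sup>2) \<le> \<bar>\<theta>\<bar> * (p * (?U \<omega>)\<^sup>2)"
        by (intro mult_left_mono) auto
      moreover have "\<bar>?U \<omega>\<bar> ^ 3 = \<bar>?U \<omega>\<bar> * (?U \<omega>)\<^sup>2"
        by (simp add: power3_eq_cube power2_eq_square)
      ultimately show "min (6 * (?U \<omega>)\<^sup>2) (\<bar>\<theta>\<bar> * \<bar>?U \<omega>\<bar> ^ 3) \<le> \<bar>\<theta>\<bar> * p * (?U \<omega>)\<^sup>2"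
        by (simp add: mult_ac)
    qed
    show "AE \<omega> in M. 0 \<le> \<bar>\<theta>\<bar> * p * (?U \<omega>)\<^sup>2" by simp
  qed
  also have "\<dots> = \<bar>\<theta>\<bar> * p * v p" by (simp add: v_def)
  finally have 1: "cmod ((LINT \<omega>|M. iexp (\<theta> * ?U \<omega>)) - complex_of_real (1 - ?x)) \<le>
      (\<theta>\<^sup>2 / 6) * (\<bar>\<theta>\<bar> * p * v p)"
    unfolding char_csum[OF sub] by (simp add: mult_left_mono)
  have x0: "0 \<le> ?x" using v0 by simp
  \<comment> \<open>The upper bound comes from
    \<open>(1 - x + x\<^sup>2) * (1 + x) = 1 + x ^ 3\<close>, which is at least 1 for
    \<open>x \<ge> 0\<close>.\<close>
  have "exp (- ?x) \<le> 1 / (1 + ?x)"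
    using exp_ge_add_one_self[of ?x] x0 by (simp add: exp_minus field_simps)
  also have "\<dots> \<le> 1 - ?x + ?x\<^sup>2"
  proof -
    have "0 \<le> ?x ^ 3" using x0 by (rule zero_le_power)
    then have "1 \<le> (1 - ?x + ?x\<^sup>2) * (1 + ?x)"
      by (simp only: power2_eq_square power3_eq_cube) (simp only: algebra_simps)
    then show ?thesis using x0 by (simp only: divide_le_eq) simp
  qed
  finally have "\<bar>(1 - ?x) - exp (- ?x)\<bar> \<le> ?x\<^sup>2"
    using exp_ge_add_one_self[of "- ?x"] by linarith
  then have 2: "cmod (complex_of_real (1 - ?x) - complex_of_real (exp (- ?x))) \<le> ?x\<^sup>2"
    unfolding of_real_diff[symmetric] norm_of_real by simp
  have "cmod ((LINT \<omega>|M. iexp (\<theta> * ?U \<omega>)) - complex_of_real (exp (- ?x))) \<le>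
      (\<theta>\<^sup>2 / 6) * (\<bar>\<theta>\<bar> * p * v p) + ?x\<^sup>2"
    using 1 2 by (rule norm_diff_triangle_le)
  also have "(\<theta>\<^sup>2 / 6) * (\<bar>\<theta>\<bar> * p * v p) = \<bar>\<theta>\<bar> ^ 3 * p * v p / 6"
    by (simp add: power3_eq_cube power2_eq_square)
  finally show ?thesis by simp
qed

section \<open>From the blocks to the full sum\<close>

lemma expectation_abs_le_sqrt:
  assumes "integrable M Y" "integrable M (\<lambda>\<omega>. (Y \<omega>)\<^sup>2)"
  shows "expectation (\<lambda>\<omega>. \<bar>Y \<omega> :: real\<bar>) \<le> sqrt (expectation (\<lambda>\<omega>. (Y \<omega>)\<^sup>2))"
proof (rule real_le_rsqrt)
  \<comment> \<open>Nonnegativity of the variance of the absolute value is Cauchy--Schwarz against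
    the constant 1.\<close>
  have "0 \<le> variance (\<lambda>\<omega>. \<bar>Y \<omega>\<bar>)" by (rule variance_positive)
  also have "\<dots> = expectation (\<lambda>\<omega>. \<bar>Y \<omega>\<bar>\<^sup>2) - (expectation (\<lambda>\<omega>. \<bar>Y \<omega>\<bar>))\<^sup>2"
    using assms by (intro variance_eq) auto
  finally show "(expectation (\<lambda>\<omega>. \<bar>Y \<omega>\<bar>))\<^sup>2 \<le> expectation (\<lambda>\<omega>. (Y \<omega>)\<^sup>2)" by simp
qed

text \<open>The map \<open>iexp\<close> is 1-Lipschitz, so dropping the times in
  \<open>A - D\<close> costs at most the first absolute moment of their sum, and the second moment
  controls that.\<close>

lemma char_remainder:
  fixes \<theta> :: real
  assumes A: "finite A" "A \<subseteq> {1..}" and D: "D \<subseteq> A"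
  shows "norm ((LINT \<omega>|M. iexp (\<theta> * csum A \<omega>)) - (LINT \<omega>|M. iexp (\<theta> * csum D \<omega>))) \<le>
    \<bar>\<theta>\<bar> * sqrt (var_const * card (A - D))"
proof -
  let ?R = "A - D"
  have sub: "D \<subseteq> {1..}" "?R \<subseteq> {1..}" using A D by auto
  have split: "csum A \<omega> = csum D \<omega> + csum ?R \<omega>" for \<omega>
    unfolding csum_def using A D by (metis add.commute sum.subset_diff)
  have int: "integrable M (\<lambda>\<omega>. iexp (\<theta> * csum E \<omega>))" if "E \<subseteq> {1..}" for E
    using that by (intro integrable_const_bound[where B = 1]) auto
  have "norm ((LINT \<omega>|M. iexp (\<theta> * csum A \<omega>)) - (LINT \<omega>|M. iexp (\<theta> * csum D \<omega>))) =
      norm (LINT \<omega>|M. iexp (\<theta> * csum A \<omega>) - iexp (\<theta> * csum D \<omega>))"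
    using int[OF A(2)] int[OF sub(1)] by simp
  also have "\<dots> \<le> expectation (\<lambda>\<omega>. norm (iexp (\<theta> * csum A \<omega>) - iexp (\<theta> * csum D \<omega>)))"
    by (rule integral_norm_bound)
  also have "\<dots> \<le> expectation (\<lambda>\<omega>. \<bar>\<theta>\<bar> * \<bar>csum ?R \<omega>\<bar>)"
  proof (intro integral_mono)
    show "integrable M (\<lambda>\<omega>. norm (iexp (\<theta> * csum A \<omega>) - iexp (\<theta> * csum D \<omega>)))"
      using int[OF A(2)] int[OF sub(1)] by (intro integrable_norm Bochner_Integration.integrable_diff)
    show "integrable M (\<lambda>\<omega>. \<bar>\<theta>\<bar> * \<bar>csum ?R \<omega>\<bar>)"
      using integrable_csum[OF sub(2)] by simp
    fix \<omega>
    have "iexp (\<theta> * csum A \<omega>) - iexp (\<theta> * csum D \<omega>) =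
        iexp (\<theta> * csum D \<omega>) * (iexp (\<theta> * csum ?R \<omega>) - 1)"
      by (simp add: split right_diff_distrib distrib_left exp_add)
    then show "norm (iexp (\<theta> * csum A \<omega>) - iexp (\<theta> * csum D \<omega>)) \<le> \<bar>\<theta>\<bar> * \<bar>csum ?R \<omega>\<bar>"
      using iexp_approx1[of "\<theta> * csum ?R \<omega>" 0] by (simp add: norm_mult abs_mult)
  qed
  also have "\<dots> = \<bar>\<theta>\<bar> * expectation (\<lambda>\<omega>. \<bar>csum ?R \<omega>\<bar>)" by simp
  also have "\<dots> \<le> \<bar>\<theta>\<bar> * sqrt (expectation (\<lambda>\<omega>. (csum ?R \<omega>)\<^sup>2))"
    using integrable_csum[OF sub(2)] integrable_csum_sq[OF sub(2)]
    by (intro mult_left_mono expectation_abs_le_sqrt) auto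
  also have "\<dots> \<le> \<bar>\<theta>\<bar> * sqrt (var_const * card ?R)"
    using A(1) sub(2) by (intro mult_left_mono real_sqrt_le_mono csum_second_moment) auto
  finally show ?thesis .
qed

text \<open>Three errors add up: dropping the gaps and the incomplete last period, factorising over
  the \<open>k\<close> blocks, and expanding each of the \<open>k\<close> equal factors.\<close>

lemma char_csum_estimate:
  fixes \<theta> :: real and k n p q :: nat and v :: "nat \<Rightarrow> real"
  defines "v \<equiv> \<lambda>p. expectation (\<lambda>\<omega>. (csum {1..p} \<omega>)\<^sup>2)"
  assumes q: "1 \<le> q" and k: "k * (p + q) \<le> n"
  shows "norm ((LINT \<omega>|M. iexp (\<theta> * csum {1..n} \<omega>)) - complex_of_real (exp (- (k * (\<theta>\<^sup>2 * v p / 2))))) \<le>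
    \<bar>\<theta>\<bar> * sqrt (var_const * (real n - real (k * p))) + k * (B * r ^ q) +
    k * (\<bar>\<theta>\<bar> ^ 3 * p * v p / 6 + (\<theta>\<^sup>2 * v p / 2)\<^sup>2)"
proof -
  let ?\<psi> = "LINT \<omega>|M. iexp (\<theta> * csum {1..p} \<omega>)"
  let ?g = "complex_of_real (exp (- (\<theta>\<^sup>2 * v p / 2)))"
  have sub: "blocks p q k \<subseteq> {1..n}"
    using blocks_subset[of p q k] k by force
  have "card ({1..n} - blocks p q k) = n - k * p"
    using sub by (simp add: card_Diff_subset card_blocks)
  moreover have "k * p \<le> n" using k by (simp add: distrib_left)
  ultimately have 1: "norm ((LINT \<omega>|M. iexp (\<theta> * csum {1..n} \<omega>)) -
      (LINT \<omega>|M. iexp (\<theta> * csum (blocks p q k) \<omega>))) \<le> \<bar>\<theta>\<bar> * sqrt (var_const * (real n - real (k * p)))"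
    using char_remainder[OF _ _ sub, of \<theta>] by (simp add: of_nat_diff)
  have "norm ?\<psi> \<le> 1"
    using real_distribution.cmod_char_le_1[OF real_distribution_distr, of "csum {1..p}" \<theta>]
      char_csum[of "{1..p}" \<theta>] by auto
  moreover have "norm ?g \<le> 1"
    by (simp add: v_def)
  \<comment> \<open>Both numbers lie in the unit disc, where taking a \<open>k\<close>-th power
    enlarges distances at most \<open>k\<close> times.\<close>
  ultimately have "norm (?\<psi> ^ k - ?g ^ k) \<le> k * norm (?\<psi> - ?g)"
    by (rule norm_power_diff)
  also have "\<dots> \<le> k * (\<bar>\<theta>\<bar> ^ 3 * p * v p / 6 + (\<theta>\<^sup>2 * v p / 2)\<^sup>2)"
    using char_block_taylor[of \<theta> p] by (intro mult_left_mono) (simp_all add: v_def)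
  also have "?g ^ k = complex_of_real (exp (- (k * (\<theta>\<^sup>2 * v p / 2))))"
    by (simp only: of_real_power[symmetric] exp_of_nat_mult[symmetric]) simp
  finally show ?thesis
    by (rule norm_diff_triangle_le[OF norm_diff_triangle_le[OF 1 char_blocks[OF q]]])
qed

end

section \<open>The limiting characteristic function\<close>

lemma char_normal_distribution:
  assumes "0 < \<sigma>"
  shows "char (density lborel (normal_density 0 \<sigma>)) t = complex_of_real (exp (- (\<sigma>\<^sup>2 * t\<^sup>2 / 2)))"
proof -
  interpret N: prob_space std_normal_distribution
    using real_dist_normal_dist by (simp add: real_distribution_def)
  have "distributed std_normal_distribution lborel (\<lambda>x. x) (normal_density 0 1)"
    by (auto simp: distributed_def distr_id2)
  from N.normal_density_affine[OF this, of \<sigma> 0] assms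
  have "distributed std_normal_distribution lborel (\<lambda>x. \<sigma> * x) (normal_density 0 \<sigma>)" by simp
  then have "density lborel (normal_density 0 \<sigma>) = distr std_normal_distribution lborel (\<lambda>x. \<sigma> * x)"
    by (simp add: distributed_distr_eq_density)
  then have "char (density lborel (normal_density 0 \<sigma>)) t = char std_normal_distribution (\<sigma> * t)"
    unfolding char_def by (simp add: integral_distr mult_ac)
  then show ?thesis
    by (simp add: char_std_normal_distribution power_mult_distrib)
qed

subsection \<open>The limit theorem\<close>

text \<open>The lower bound on \<open>n\<close> makes the block length \<open>q\<^sup>2\<close>
  small against \<open>sqrt n\<close>. The upper bound makes the number of blocks at most polynomial
  in \<open>q\<close>, so that \<open>r ^ q\<close> beats it.\<close>

lemma root_block_size:
  defines "q \<equiv> \<lambda>n. nat \<lfloor>root 6 (real n)\<rfloor>"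
  shows "real (q n) ^ 6 \<le> real n" "real n \<le> (real (q n) + 1) ^ 6"
    "filterlim q at_top sequentially"
proof -
  have r: "root 6 (real n) ^ 6 = real n" "0 \<le> root 6 (real n)" for n
    by (auto simp: real_root_pow_pos2)
  have "real (q n) \<le> root 6 (real n)"
    unfolding q_def using r(2)[of n] by (simp add: of_nat_floor)
  then show "real (q n) ^ 6 \<le> real n"
    using power_mono[of "real (q n)" "root 6 (real n)" 6] r(1) by simp
  have "root 6 (real n) \<le> real (q n) + 1"
    unfolding q_def using r(2)[of n] by linarith
  then show "real n \<le> (real (q n) + 1) ^ 6"
    using power_mono[of "root 6 (real n)" "real (q n) + 1" 6] r by simp
  have "Z \<le> q n" if "Z ^ 6 \<le> n" for Z n
  proof -
    have "root 6 (real (Z ^ 6)) \<le> root 6 (real n)"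
      using that by (subst real_root_le_iff) (auto simp flip: of_nat_power)
    then have "real Z \<le> root 6 (real n)"
      by (simp add: real_root_power_cancel)
    then show ?thesis unfolding q_def by (rule le_nat_floor)
  qed
  then show "filterlim q at_top sequentially"
    unfolding filterlim_at_top eventually_sequentially by blast
qed

text \<open>With \<open>s = root 6 r\<close> the expression is the sixth power of
  \<open>(q + 1) * s ^ (q + 1)\<close>, divided by \<open>r\<close>.\<close>

lemma power_times_geometric_tendsto_0:
  fixes r :: real
  assumes "0 < r" "r < 1"
  shows "(\<lambda>q. (real q + 1) ^ 6 * r ^ q) \<longlonglongrightarrow> 0"
proof -
  let ?s = "root 6 r"
  have s: "?s ^ 6 = r" "0 < ?s" "?s < 1"
    using assms by auto
  have "(\<lambda>q. real (Suc q) * ?s ^ Suc q) \<longlonglongrightarrow> 0"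
    using powser_times_n_limit_0[of ?s] s by (intro LIMSEQ_Suc) auto
  then have "(\<lambda>q. (real (Suc q) * ?s ^ Suc q) ^ 6 / r) \<longlonglongrightarrow> 0 ^ 6 / r"
    using assms by (intro tendsto_intros) auto
  moreover have "(real (Suc q) * ?s ^ Suc q) ^ 6 / r = (real q + 1) ^ 6 * r ^ q" for q
  proof -
    have "(?s ^ Suc q) ^ 6 = (?s ^ 6) ^ Suc q"
      by (simp only: power_mult[symmetric] mult.commute)
    then show ?thesis using assms s(1) by (simp add: power_mult_distrib add.commute)
  qed
  ultimately show ?thesis by simp
qed

text \<open>The times outside the blocks are \<open>k\<close> gaps, together at most
  \<open>k * q \<le> n / q\<close>, and an incomplete period shorter than
  \<open>q\<^sup>2 + q\<close>, which is at most \<open>2 * n / q\<close>. Hence the 3.\<close>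

lemma block_count_bounds:
  fixes n q :: nat
  defines "k \<equiv> n div (q\<^sup>2 + q)"
  assumes q: "1 \<le> q" and n: "real q ^ 6 \<le> real n"
  shows "k * (q\<^sup>2 + q) \<le> n" "real k * real (q\<^sup>2) \<le> real n"
    "real k \<le> real n" "(real n - real (k * q\<^sup>2)) / real n \<le> 3 / real q"
proof -
  show 1: "k * (q\<^sup>2 + q) \<le> n" by (simp add: k_def)
  then have "k * q\<^sup>2 \<le> n" by (simp add: distrib_left)
  then have "real (k * q\<^sup>2) \<le> real n" by (rule of_nat_mono)
  then show "real k * real (q\<^sup>2) \<le> real n" by simp
  show "real k \<le> real n" by (simp add: k_def)
  have q1: "1 \<le> real q" using q by simp
  then have "1 \<le> real q ^ 6" by (rule one_le_power)
  then have n0: "0 < real n" using n by linarith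
  have "n < k * (q\<^sup>2 + q) + (q\<^sup>2 + q)"
    using dividend_less_div_times[of "q\<^sup>2 + q" n] q by (simp add: k_def)
  then have "n \<le> k * q\<^sup>2 + k * q + (q\<^sup>2 + q)"
    by (simp add: distrib_left)
  then have "real n \<le> real (k * q\<^sup>2 + k * q + (q\<^sup>2 + q))"
    by (rule of_nat_mono)
  then have "real n - real (k * q\<^sup>2) \<le> real k * real q + ((real q)\<^sup>2 + real q)"
    by simp
  then have "(real n - real (k * q\<^sup>2)) * real q \<le> (real k * real q + ((real q)\<^sup>2 + real q)) * real q"
    by (intro mult_right_mono) auto
  also have "\<dots> = real k * (real q)\<^sup>2 + (real q ^ 3 + real q ^ 2)"
    by (simp add: algebra_simps power2_eq_square power3_eq_cube)
  also have "\<dots> \<le> real n + (real n + real n)"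
  proof (intro add_mono)
    show "real k * (real q)\<^sup>2 \<le> real n" using \<open>real k * real (q\<^sup>2) \<le> real n\<close> by simp
    have "real q ^ 3 \<le> real q ^ 6" "real q ^ 2 \<le> real q ^ 6" using q1 by (auto intro!: power_increasing)
    then show "real q ^ 3 \<le> real n" "real q ^ 2 \<le> real n" using n by (blast intro: order.trans)+
  qed
  finally show "(real n - real (k * q\<^sup>2)) / real n \<le> 3 / real q"
    using n0 q1 by (simp add: divide_simps)
qed

section \<open>Vanishing error and weak convergence\<close>

context bounded_mixing
begin

text \<open>The three errors of \<open>char_csum_estimate\<close> in the same order, bounded in
  terms of \<open>q\<close> alone so that the limit can be taken in one variable.\<close>

definition rate :: "real \<Rightarrow> nat \<Rightarrow> real" where
  "rate t q = \<bar>t\<bar> * sqrt (var_const * (3 / real q)) + B * ((real q + 1) ^ 6 * r ^ q) +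
    (\<bar>t\<bar> ^ 3 * var_const / 6 / real q + t ^ 4 * var_const\<^sup>2 / 4 / real q)"

lemma rate_tendsto_0: "rate t \<longlonglongrightarrow> 0"
proof -
  have "(\<lambda>q. \<bar>t\<bar> * sqrt (var_const * (3 / real q)) + B * ((real q + 1) ^ 6 * r ^ q) +
      (\<bar>t\<bar> ^ 3 * var_const / 6 / real q + t ^ 4 * var_const\<^sup>2 / 4 / real q)) \<longlonglongrightarrow>
      \<bar>t\<bar> * sqrt (var_const * 0) + B * 0 + (0 + 0)"
    using power_times_geometric_tendsto_0[OF r_pos r_less_1]
    by (intro tendsto_intros lim_const_over_n)
  then show ?thesis by (simp add: rate_def[abs_def])
qed

text \<open>With block length \<open>q\<^sup>2\<close>, the factor \<open>k * q\<^sup>2 / n\<close>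
  is at most 1. In the two expansion errors there remains \<open>q\<^sup>2 / sqrt n\<close> or
  \<open>q\<^sup>2 / n\<close>, and each is at most \<open>1 / q\<close>.\<close>

lemma char_csum_rate:
  fixes n q :: nat and t :: real
  defines "v p \<equiv> expectation (\<lambda>\<omega>. (csum {1..p} \<omega>)\<^sup>2)"
    and "k \<equiv> n div (q\<^sup>2 + q)" and "\<theta> \<equiv> t / sqrt (real n)"
  assumes q: "1 \<le> q" and n: "real q ^ 6 \<le> real n" "real n \<le> (real q + 1) ^ 6"
  shows "norm ((LINT \<omega>|M. iexp (\<theta> * csum {1..n} \<omega>)) - complex_of_real (exp (- (k * (\<theta>\<^sup>2 * v (q\<^sup>2) / 2))))) \<le> rate t q"
proof -
  let ?V = var_const
  note K = block_count_bounds[OF q n(1), folded k_def]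
  have q1: "1 \<le> real q" using q by simp
  then have "1 \<le> real q ^ 6" by (rule one_le_power)
  then have n0: "0 < real n" using n by linarith
  have V0: "0 \<le> ?V" using var_const_pos by simp
  have v0: "0 \<le> v (q\<^sup>2)" unfolding v_def by (rule integral_nonneg_AE) auto
  have v: "v (q\<^sup>2) \<le> ?V * real (q\<^sup>2)"
    using csum_second_moment[of "{1..q\<^sup>2}"] by (simp add: v_def)
  have "real q ^ 3 \<le> sqrt (real n)"
    using n(1) by (intro real_le_rsqrt) (simp flip: power_mult)
  then have sq: "real (q\<^sup>2) / sqrt (real n) \<le> 1 / real q"
    using n0 q1 by (simp add: divide_simps power3_eq_cube power2_eq_square mult_ac)
  have "real (q\<^sup>2) * real q \<le> real q ^ 6"
    using power_increasing[of 3 6 "real q"] q1 by (simp add: power3_eq_cube power2_eq_square mult_ac)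
  then have "real (q\<^sup>2) * real q \<le> real n"
    using n(1) by (rule order.trans)
  then have sn: "real (q\<^sup>2) / real n \<le> 1 / real q"
    using n0 q1 by (simp add: divide_simps)
  have th2: "\<theta>\<^sup>2 = t\<^sup>2 / real n"
    by (simp add: \<theta>_def power_divide)
  have th3: "\<bar>\<theta>\<bar> ^ 3 = \<bar>t\<bar> ^ 3 / (real n * sqrt (real n))"
    by (simp add: \<theta>_def power_divide power3_eq_cube)
  have "\<bar>\<theta>\<bar> * sqrt (?V * (real n - real (k * q\<^sup>2))) = \<bar>t\<bar> * sqrt (?V * ((real n - real (k * q\<^sup>2)) / real n))"
    using n0 by (simp add: \<theta>_def real_sqrt_mult real_sqrt_divide)
  also have "\<dots> \<le> \<bar>t\<bar> * sqrt (?V * (3 / real q))"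
    using K(4) V0 by (intro mult_left_mono real_sqrt_le_mono) auto
  finally have 1: "\<bar>\<theta>\<bar> * sqrt (?V * (real n - real (k * q\<^sup>2))) \<le> \<bar>t\<bar> * sqrt (?V * (3 / real q))" .
  \<comment> \<open>The crude \<open>k \<le> n\<close> suffices, since the geometric factor absorbs
    any power of \<open>q\<close>.\<close>
  have "k * (B * r ^ q) \<le> (real q + 1) ^ 6 * (B * r ^ q)"
    using K(3) n(2) B_nonneg r_pos by (intro mult_right_mono) auto
  then have 2: "k * (B * r ^ q) \<le> B * ((real q + 1) ^ 6 * r ^ q)" by (simp add: mult_ac)
  have "k * (\<bar>\<theta>\<bar> ^ 3 * real (q\<^sup>2) * v (q\<^sup>2) / 6) \<le> k * (\<bar>\<theta>\<bar> ^ 3 * real (q\<^sup>2) * (?V * real (q\<^sup>2)) / 6)"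
    using v by (intro mult_left_mono divide_right_mono) auto
  also have "\<dots> = \<bar>t\<bar> ^ 3 * ?V / 6 * (real k * real (q\<^sup>2) / real n) * (real (q\<^sup>2) / sqrt (real n))"
    unfolding th3 by (simp add: mult_ac)
  also have "\<dots> \<le> \<bar>t\<bar> ^ 3 * ?V / 6 * 1 * (1 / real q)"
    using K(2) n0 sq V0 by (intro mult_mono) (auto simp: divide_le_eq)
  finally have 3: "k * (\<bar>\<theta>\<bar> ^ 3 * real (q\<^sup>2) * v (q\<^sup>2) / 6) \<le> \<bar>t\<bar> ^ 3 * ?V / 6 / real q" by simp
  have "k * (\<theta>\<^sup>2 * v (q\<^sup>2) / 2)\<^sup>2 \<le> k * (\<theta>\<^sup>2 * (?V * real (q\<^sup>2)) / 2)\<^sup>2"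
    using v v0 by (intro mult_left_mono power_mono divide_right_mono) auto
  also have "\<dots> = t ^ 4 * ?V\<^sup>2 / 4 * (real k * real (q\<^sup>2) / real n) * (real (q\<^sup>2) / real n)"
    unfolding th2 by (simp add: power2_eq_square power4_eq_xxxx mult_ac)
  also have "\<dots> \<le> t ^ 4 * ?V\<^sup>2 / 4 * 1 * (1 / real q)"
    using K(2) n0 sn V0 by (intro mult_mono) (auto simp: divide_le_eq)
  finally have 4: "k * (\<theta>\<^sup>2 * v (q\<^sup>2) / 2)\<^sup>2 \<le> t ^ 4 * ?V\<^sup>2 / 4 / real q" by simp
  show ?thesis
    using char_csum_estimate[OF q K(1), of \<theta>] 1 2 3 4
    by (simp add: rate_def v_def distrib_left)
qed

text \<open>By Levy's continuity theorem it suffices that \<open>\<phi> n\<close> converges. It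
  eventually differs from \<open>g n\<close> by at most \<open>rate t (q n)\<close>, so only the
  explicit exponent of \<open>g\<close> has to be followed to its limit.\<close>

theorem csum_clt:
  assumes lim: "(\<lambda>n. expectation (\<lambda>\<omega>. (csum {1..n} \<omega>)\<^sup>2) / real n) \<longlonglongrightarrow> \<sigma>2" and pos: "0 < \<sigma>2"
  shows "weak_conv_m (\<lambda>n. distr M borel (\<lambda>\<omega>. csum {1..n} \<omega> / sqrt (real n)))
    (density lborel (normal_density 0 (sqrt \<sigma>2)))"
proof (rule levy_continuity)
  have sub: "{1..n::nat} \<subseteq> {1..}" for n by auto
  show "real_distribution (distr M borel (\<lambda>\<omega>. csum {1..n} \<omega> / sqrt (real n)))" for n
    using sub by (intro real_distribution_distr) auto
  show "real_distribution (density lborel (normal_density 0 (sqrt \<sigma>2)))"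
    using pos by (intro real_distribution.intro prob_space_normal_density)
      (auto simp: real_distribution_axioms_def)
  fix t :: real
  define v where "v p = expectation (\<lambda>\<omega>. (csum {1..p} \<omega>)\<^sup>2)" for p :: nat
  define q where "q n = nat \<lfloor>root 6 (real n)\<rfloor>" for n :: nat
  define k where "k n = n div ((q n)\<^sup>2 + q n)" for n :: nat
  define g where "g n = exp (- (real (k n) * ((t / sqrt (real n))\<^sup>2 * v ((q n)\<^sup>2) / 2)))" for n :: nat
  define \<phi> where "\<phi> n = char (distr M borel (\<lambda>\<omega>. csum {1..n} \<omega> / sqrt (real n))) t" for n
  note q = root_block_size[folded q_def]
  have q1: "\<forall>\<^sub>F n in sequentially. 1 \<le> q n"
    using q(3) by (simp add: filterlim_at_top)
  have phi: "\<phi> n = (LINT \<omega>|M. iexp (t / sqrt (real n) * csum {1..n} \<omega>))" for n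
    unfolding \<phi>_def char_def using sub by (subst integral_distr) auto
  have "\<forall>\<^sub>F n in sequentially. norm (\<phi> n - complex_of_real (g n)) \<le> rate t (q n)"
    using q1
  proof (elim eventually_mono)
    fix n assume "1 \<le> q n"
    from char_csum_rate[OF this q(1,2), of t]
    show "norm (\<phi> n - complex_of_real (g n)) \<le> rate t (q n)"
      unfolding phi g_def k_def v_def .
  qed
  moreover have "(\<lambda>n. rate t (q n)) \<longlonglongrightarrow> 0"
    using rate_tendsto_0 q(3) by (rule filterlim_compose)
  ultimately have diff: "(\<lambda>n. \<phi> n - complex_of_real (g n)) \<longlonglongrightarrow> 0"
    by (rule Lim_null_comparison)
  have ratio: "(\<lambda>n. real (k n * (q n)\<^sup>2) / real n) \<longlonglongrightarrow> 1"
  proof -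
    have "(\<lambda>n. (real n - real (k n * (q n)\<^sup>2)) / real n) \<longlonglongrightarrow> 0"
    proof (rule tendsto_sandwich)
      show "\<forall>\<^sub>F n in sequentially. 0 \<le> (real n - real (k n * (q n)\<^sup>2)) / real n"
        using q1 by eventually_elim (use block_count_bounds(2)[OF _ q(1)] in \<open>simp add: k_def\<close>)
      show "\<forall>\<^sub>F n in sequentially. (real n - real (k n * (q n)\<^sup>2)) / real n \<le> 3 / real (q n)"
        using q1 by eventually_elim (use block_count_bounds(4)[OF _ q(1)] in \<open>simp add: k_def\<close>)
      show "(\<lambda>n. 3 / real (q n)) \<longlonglongrightarrow> 0"
        using lim_const_over_n q(3) by (rule filterlim_compose)
    qed simp
    then have "(\<lambda>n. 1 - (real n - real (k n * (q n)\<^sup>2)) / real n) \<longlonglongrightarrow> 1 - 0"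
      by (intro tendsto_intros)
    \<comment> \<open>Only eventually, because at \<open>n = 0\<close> division by zero gives 1 on
      the left and 0 on the right.\<close>
    moreover have "\<forall>\<^sub>F n in sequentially. 1 - (real n - real (k n * (q n)\<^sup>2)) / real n =
        real (k n * (q n)\<^sup>2) / real n"
      using eventually_gt_at_top[of 0] by eventually_elim (simp add: diff_divide_distrib)
    ultimately show ?thesis by (simp add: filterlim_cong)
  qed
  have "filterlim (\<lambda>n. (q n)\<^sup>2) at_top sequentially"
    using q(3) by (rule filterlim_at_top_mono) (simp add: power2_nat_le_imp_le self_le_power)
  then have vlim: "(\<lambda>n. v ((q n)\<^sup>2) / real ((q n)\<^sup>2)) \<longlonglongrightarrow> \<sigma>2"
    using lim unfolding v_def by (intro filterlim_compose[OF lim])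
  \<comment> \<open>The exponent of \<open>g n\<close> splits into the covered fraction of
    \<open>{1..n}\<close>, which tends to 1, and the normalised variance of one block, which tends
    to \<open>\<sigma>2\<close> because block lengths diverge.\<close>
  have "(\<lambda>n. exp (- (t\<^sup>2 / 2 * (real (k n * (q n)\<^sup>2) / real n) * (v ((q n)\<^sup>2) / real ((q n)\<^sup>2)))))
      \<longlonglongrightarrow> exp (- (t\<^sup>2 / 2 * 1 * \<sigma>2))"
    by (intro tendsto_intros ratio vlim)
  moreover have "\<forall>\<^sub>F n in sequentially.
      exp (- (t\<^sup>2 / 2 * (real (k n * (q n)\<^sup>2) / real n) * (v ((q n)\<^sup>2) / real ((q n)\<^sup>2)))) = g n"
    using q1 by eventually_elim (simp add: g_def power_divide mult_ac)
  ultimately have "g \<longlonglongrightarrow> exp (- (t\<^sup>2 / 2 * 1 * \<sigma>2))"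
    by (rule Lim_transform_eventually)
  then have "(\<lambda>n. complex_of_real (g n)) \<longlonglongrightarrow> complex_of_real (exp (- (t\<^sup>2 / 2 * 1 * \<sigma>2)))"
    by (rule tendsto_of_real)
  from tendsto_add[OF diff this] have "\<phi> \<longlonglongrightarrow> complex_of_real (exp (- (t\<^sup>2 / 2 * 1 * \<sigma>2)))"
    by simp
  then show "(\<lambda>n. char (distr M borel (\<lambda>\<omega>. csum {1..n} \<omega> / sqrt (real n))) t) \<longlonglongrightarrow>
      char (density lborel (normal_density 0 (sqrt \<sigma>2))) t"
    using pos by (simp add: char_normal_distribution \<phi>_def[abs_def] mult.commute)
qed

end

section \<open>From the information hypothesis to the indicator process\<close>

lemma simple_function_window:
  assumes "finite J" "\<And>i. i \<in> J \<Longrightarrow> simple_function M (X i)"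
  shows "simple_function M (window X J)"
  using assms
proof (induction J rule: finite_induct)
  case empty
  then show ?case by (simp add: window_def[abs_def])
next
  case (insert a J)
  have "simple_function M (\<lambda>\<omega>. (window X J \<omega>)(a := X a \<omega>))"
    using insert by (intro simple_function_compose2[where h = "\<lambda>w y. w(a := y)"]) auto
  also have "(\<lambda>\<omega>. (window X J \<omega>)(a := X a \<omega>)) = window X (insert a J)"
    by (auto simp: window_def fun_eq_iff restrict_def)
  finally show ?case .
qed

lemma window_mutual_information_le_process:
  assumes "finite J" "J \<subseteq> A" "finite K" "K \<subseteq> B" "process_mutual_information M X A B \<le> ereal c"
  shows "window_mutual_information M X J K \<le> c"
proof -
  have "ereal (window_mutual_information M X J K) \<le> process_mutual_information M X A B"
    unfolding process_mutual_information_def using assms(1-4)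
    by (intro SUP_upper2[of "(J, K)"]) auto
  then show ?thesis using assms(5) by (meson ereal_less_eq(3) order.trans)
qed

theorem theorem3p8:
  fixes M :: "'a measure"
    and x :: "nat \<Rightarrow> 'a \<Rightarrow> 'v"
    and G :: "nat \<Rightarrow> 'a \<Rightarrow> 'v set"
    and I S :: "nat \<Rightarrow> 'a \<Rightarrow> real"
    and C \<rho> \<sigma>2 \<gamma>' :: real
  defines "I \<equiv> green_indicator x G"
    and "S \<equiv> (\<lambda>n \<omega>. \<Sum>t=1..n. I t \<omega>)"
  assumes "prob_space M"
    and "\<And>t. t \<ge> 1 \<Longrightarrow> I t \<in> borel_measurable M"
    and "strictly_stationary M I"
    and "C > 0" and "0 < \<rho>" and "\<rho> < 1"
    and "\<And>s t. 1 \<le> s \<Longrightarrow> s < t \<Longrightarrow>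
           process_mutual_information M I {t..} {1..<s} \<le> ereal (C * \<rho> ^ (t - s))"
    and "(\<lambda>n. prob_space.variance M (S n) / real n) \<longlonglongrightarrow> \<sigma>2"
    and "\<sigma>2 > 0"
    and "\<And>t. t \<ge> 1 \<Longrightarrow> prob_space.expectation M (I t) = \<gamma>'"
    and "0 < \<gamma>'" and "\<gamma>' < 1"
  shows "\<exists>c>0. weak_conv_m
           (\<lambda>n. distr M borel (\<lambda>\<omega>. sqrt (real n) * (S n \<omega> / real n - \<gamma>')))
           (density lborel (normal_density 0 (sqrt (c * \<gamma>' * (1 - \<gamma>')))))"
proof -
  note meas = assms(4) and MI = assms(9) and mean = assms(12)
  interpret prob_space M by fact
  interpret information_space M 2 by standard simp
  have I01: "I t \<omega> \<in> {0, 1}" for t \<omega>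
    by (simp add: I_def green_indicator_def)
  have simple: "simple_function M (I t)" if "1 \<le> t" for t
    using meas[OF that] I01 by (intro simple_function_borel_measurable) (auto intro: finite_subset[of _ "{0, 1}"])
  \<comment> \<open>The square root in the decoupling bound halves the decay exponent, hence
    \<open>sqrt \<rho>\<close>; the factor \<open>ln 2\<close> converts information measured in
    bits.\<close>
  interpret bounded_mixing M I \<gamma>' "2 * sqrt (ln 2 * C)" "sqrt \<rho>"
  proof
    show "\<bar>I i \<omega> - \<gamma>'\<bar> \<le> 1" for i \<omega>
      using I01[of i \<omega>] \<open>0 < \<gamma>'\<close> \<open>\<gamma>' < 1\<close> by auto
    fix s t :: nat and J K :: "nat set" and f g :: "(nat \<Rightarrow> real) \<Rightarrow> complex"
    assume st: "1 \<le> s" "s < t" and J: "finite J" "J \<subseteq> {t..}" and K: "finite K" "K \<subseteq> {1..<s}"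
      and f: "\<And>w. norm (f w) \<le> 1" and g: "\<And>w. norm (g w) \<le> 1"
    have sf: "simple_function M (window I J)" "simple_function M (window I K)"
      using st J K by (auto intro!: simple_function_window simple)
    have MI': "window_mutual_information M I J K \<le> C * \<rho> ^ (t - s)"
      using J K MI[OF st] by (intro window_mutual_information_le_process)
    have "norm ((LINT \<omega>|M. f (window I J \<omega>) * g (window I K \<omega>)) -
        (LINT \<omega>|M. f (window I J \<omega>)) * (LINT \<omega>|M. g (window I K \<omega>)))
        \<le> 2 * sqrt (ln 2 * window_mutual_information M I J K)"
      unfolding window_mutual_information_def
      using sf f g by (rule decoupling_le_sqrt_mutual_information)
    also have "\<dots> \<le> 2 * sqrt (ln 2 * (C * \<rho> ^ (t - s)))"
      using MI' by simp
    also have "\<dots> = 2 * sqrt (ln 2 * C) * sqrt \<rho> ^ (t - s)"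
      by (simp add: real_sqrt_mult real_sqrt_power)
    finally show "norm ((LINT \<omega>|M. f (window I J \<omega>) * g (window I K \<omega>)) -
        (LINT \<omega>|M. f (window I J \<omega>)) * (LINT \<omega>|M. g (window I K \<omega>)))
        \<le> 2 * sqrt (ln 2 * C) * sqrt \<rho> ^ (t - s)" .
  qed (use assms in auto)
  have csum_S: "csum {1..n} \<omega> = S n \<omega> - n * \<gamma>'" for n \<omega>
    by (simp add: csum_def S_def sum_subtractf)
  have "\<bar>I t \<omega>\<bar> \<le> 1" for t \<omega>
    using I01[of t \<omega>] by auto
  then have "integrable M (I t)" if "1 \<le> t" for t
    using meas[OF that] by (intro integrable_bounded[where c = 1])
  \<comment> \<open>This identifies the centring in the variance of assumption (ii) with
    \<open>n * \<gamma>'\<close>, so that the variance is the second moment of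
    \<open>csum {1..n}\<close>.\<close>
  then have "expectation (S n) = (\<Sum>t=1..n. expectation (I t))" for n
    unfolding S_def by (intro Bochner_Integration.integral_sum) auto
  then have "expectation (S n) = n * \<gamma>'" for n
    using mean by simp
  then have "(\<lambda>n. expectation (\<lambda>\<omega>. (csum {1..n} \<omega>)\<^sup>2) / real n) \<longlonglongrightarrow> \<sigma>2"
    unfolding csum_S using assms(10) by simp
  from csum_clt[OF this \<open>\<sigma>2 > 0\<close>]
  have "weak_conv_m (\<lambda>n. distr M borel (\<lambda>\<omega>. csum {1..n} \<omega> / sqrt (real n)))
      (density lborel (normal_density 0 (sqrt \<sigma>2)))" .
  \<comment> \<open>At \<open>n = 0\<close> both sides are 0, so the identity holds for every
    \<open>n\<close>.\<close>
  moreover have "csum {1..n} \<omega> / sqrt (real n) = sqrt (real n) * (S n \<omega> / real n - \<gamma>')" for n \<omega>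
    unfolding csum_S by (cases "n = 0") (simp_all add: field_simps)
  moreover have "\<sigma>2 / (\<gamma>' * (1 - \<gamma>')) * \<gamma>' * (1 - \<gamma>') = \<sigma>2"
    using \<open>0 < \<gamma>'\<close> \<open>\<gamma>' < 1\<close> by simp
  ultimately show ?thesis
    using \<open>0 < \<gamma>'\<close> \<open>\<gamma>' < 1\<close> \<open>\<sigma>2 > 0\<close>
    by (intro exI[of _ "\<sigma>2 / (\<gamma>' * (1 - \<gamma>'))"]) simp
qed

end
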